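(* Let $c > 1$ and let $\phi \in A_1((0,1), c)$. Then for every $p \in [1, \frac{c}{c-1})$ we have $\phi \in L^p(0,1)$ and $$\frac{1}{|I|}\int_I \phi^p \leq \frac{1}{c^{p-1}(c+p-pc)}\left(\frac{1}{|I|}\int_I \phi\right)^p$$ for every subinterval $I$ of $(0,1)$. Moreover, this inequality is best possible: for every $c>1$ and every $p \in [1,\frac{c}{c-1})$, the constant $\frac{1}{c^{p-1}(c+p-pc)}$ cannot be replaced by any smaller number.
   Context: $|\cdot|$ denotes Lebesgue measure. For an interval $J$, a function $\phi : J \to \mathbb{R}^+$ satisfies the $A_1$ condition with constant $c\ge 1$ if $\frac{1}{|I|}\int_I \phi(x)\,dx \leq c\cdot \operatorname{ess\,inf}_I(\phi)$ for every subinterval $I \subseteq J$. The least such constant is called the $A_1$ constant of $\phi$, denoted $[\phi]_1$, and $\phi \in A_1(J,c)$ means that $\phi$ belongs to the $A_1$ class of $J$ with $A_1$ constant $c$, i.e. $[\phi]_1 = c$. *)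

theory Defs
  imports "HOL-Analysis.Analysis"
begin

definition subinterval :: "real set \<Rightarrow> real set \<Rightarrow> bool" where
  "subinterval I J \<longleftrightarrow> is_interval I \<and> I \<subseteq> J \<and> measure lebesgue I > 0"

definition ess_inf_on :: "real set \<Rightarrow> (real \<Rightarrow> real) \<Rightarrow> real" where
  "ess_inf_on I f = Sup {a. AE x in lebesgue. x \<in> I \<longrightarrow> a \<le> f x}"

definition avg :: "real set \<Rightarrow> (real \<Rightarrow> real) \<Rightarrow> real" where
  "avg I f = (\<integral>x\<in>I. f x \<partial>lebesgue) / measure lebesgue I"

definition A1_cond :: "real set \<Rightarrow> (real \<Rightarrow> real) \<Rightarrow> real \<Rightarrow> bool" where
  "A1_cond J \<phi> c \<longleftrightarrow> c \<ge> 1 \<and> (\<forall>x\<in>J. \<phi> x > 0) \<and>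
     (\<forall>I. subinterval I J \<longrightarrow>
        set_integrable lebesgue I \<phi> \<and> avg I \<phi> \<le> c * ess_inf_on I \<phi>)"

definition A1_const :: "real set \<Rightarrow> (real \<Rightarrow> real) \<Rightarrow> real" where
  "A1_const J \<phi> = Inf {c. A1_cond J \<phi> c}"

definition A1_class :: "real set \<Rightarrow> real \<Rightarrow> (real \<Rightarrow> real) \<Rightarrow> bool" where
  "A1_class J c \<phi> \<longleftrightarrow> (\<exists>c'. A1_cond J \<phi> c') \<and> A1_const J \<phi> = c"

end

theory Submission
  imports Defs "HOL-Real_Asymp.Real_Asymp"
begin

text \<open>
  Let \<open>m\<close> be the essential infimum of \<open>\<phi>\<close> on an interval \<open>I\<close> and \<open>A\<close> its average. For \<open>t > m\<close>
  the set \<open>E = {\<phi> > t}\<close> can be approximated from outside by unions of disjoint intervals on which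
  the \<open>A\<^sub>1\<close> condition bounds the average by \<open>c t\<close>, whence the weak-type bound
  \<open>\<integral>\<^sub>E \<phi> \<le> c t |E|\<close>. Integrating it against \<open>t\<^bsup>p-2\<^esup>\<close> over \<open>t > m\<close> yields
  \<open>(c + p - p c) \<integral> \<phi>\<^sup>p \<le> (p m\<^bsup>p-1\<^esup> A - c (p - 1) m\<^sup>p) |I|\<close>, and the right-hand side is largest at
  \<open>m = A / c\<close>. Equality holds for \<open>\<phi> x = x\<^bsup>1/c-1\<^esup>\<close> on the whole unit interval.
\<close>

subsection \<open>Passing from intervals to measurable sets\<close>

text \<open>Lets arbitrary intervals be replaced by open ones: only the two endpoints, a null set,
  remain undecided.\<close>

lemma bounded_interval_between:
  fixes S :: "real set"
  assumes "is_interval S" "S \<noteq> {}" "bounded S"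
  obtains a b where "{a<..<b} \<subseteq> S" "S \<subseteq> {a..b}"
proof -
  have "S \<subseteq> {Inf S..Sup S}"
    using \<open>bounded S\<close>
    by (auto intro!: cInf_lower cSup_upper bounded_imp_bdd_above bounded_imp_bdd_below)
  moreover have "{Inf S<..<Sup S} \<subseteq> S"
  proof
    fix x assume "x \<in> {Inf S<..<Sup S}"
    then obtain y z where "y \<in> S" "y < x" "z \<in> S" "x < z"
      using \<open>S \<noteq> {}\<close> \<open>bounded S\<close> by (metis cInf_lessD greaterThanLessThan_iff less_cSupD)
    then show "x \<in> S"
      using \<open>is_interval S\<close> by (meson is_interval_1 less_imp_le)
  qed
  ultimately show ?thesis using that by blast
qed

lemma open_bounded_interval_real:
  fixes S :: "real set"
  assumes "open S" "is_interval S" "S \<noteq> {}" "bounded S"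
  obtains u v where "u < v" "S = {u<..<v}"
proof -
  obtain a b where ab: "{a<..<b} \<subseteq> S" "S \<subseteq> {a..b}"
    using bounded_interval_between assms(2-4) .
  have "S = {a<..<b}"
    using ab interior_mono[OF ab(2)] interior_open[OF \<open>open S\<close>] by auto
  then show ?thesis using that \<open>S \<noteq> {}\<close> by (metis greaterThanLessThan_empty_iff linorder_not_less)
qed

lemma set_integral_cong_set':
  fixes f :: "_ \<Rightarrow> _ :: {banach, second_countable_topology}"
  assumes "set_integrable M A f" "set_integrable M B f" "AE x in M. x \<in> A \<longleftrightarrow> x \<in> B"
  shows "(LINT x:A|M. f x) = (LINT x:B|M. f x)"
proof -
  have "AE x in M. indicator A x *\<^sub>R f x = indicator B x *\<^sub>R f x"
    using assms(3) by eventually_elim (simp add: indicator_def)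
  then show ?thesis
    using assms(1,2) unfolding set_lebesgue_integral_def set_integrable_def
    by (intro integral_cong_AE borel_measurable_integrable)
qed

text \<open>An open set of reals has countably many components. The integral is additive over
  finitely many of them, and continuity from below carries the sign over to their union
  \<open>G\<close>.\<close>

lemma set_integral_open_nonpos:
  fixes g :: "real \<Rightarrow> real"
  assumes "open G" and int: "set_integrable lebesgue G g"
    and nonpos: "\<And>C. C \<in> components G \<Longrightarrow> (LINT x:C|lebesgue. g x) \<le> 0"
  shows "(LINT x:G|lebesgue. g x) \<le> 0"
proof -
  let ?K = "components G"
  have cnt: "countable ?K"
    using \<open>open G\<close> open_components pairwise_disjoint_components[of G]
    by (intro countable_disjoint_open_subsets) (auto simp: disjoint_def pairwise_def disjnt_def)
  \<comment> \<open>Indices that number no component give the empty set, so finitely and infinitely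
    many components are treated alike.\<close>
  define A where "A n = \<Union>{C \<in> ?K. to_nat_on ?K C = n}" for n
  have A: "A n = {} \<or> A n \<in> ?K" for n
  proof (cases "\<exists>C\<in>?K. to_nat_on ?K C = n")
    case True
    then obtain C where C: "C \<in> ?K" "to_nat_on ?K C = n" by blast
    then have "{C \<in> ?K. to_nat_on ?K C = n} = {C}"
      using cnt by (auto dest: inj_on_to_nat_on inj_onD)
    then show ?thesis using C by (simp add: A_def)
  qed (auto simp: A_def)
  have UN: "(\<Union>n. A n) = G"
    using Union_components[of G] unfolding A_def by blast
  have op: "open (A n)" for n
    using A[of n] \<open>open G\<close> open_components by auto
  have disj: "A i \<inter> A j = {}" if "i \<noteq> j" for i j
  proof -
    have "C \<inter> D = {}" if "C \<in> ?K" "D \<in> ?K" "to_nat_on ?K C = i" "to_nat_on ?K D = j" for C D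
      using that \<open>i \<noteq> j\<close> pairwise_disjoint_components[of G] unfolding pairwise_def by metis
    then show ?thesis unfolding A_def by blast
  qed
  have le: "(LINT x:A n|lebesgue. g x) \<le> 0" for n
    using A[of n] nonpos by (auto simp: set_lebesgue_integral_def)
  define B where "B n = (\<Union>i<n. A i)" for n
  have "(\<Union>n. B n) = G"
    using UN unfolding B_def by blast
  then have lim: "(\<lambda>n. LINT x:B n|lebesgue. g x) \<longlonglongrightarrow> (LINT x:G|lebesgue. g x)"
    using op int set_integral_cont_up[of B lebesgue g]
    by (force simp: B_def incseq_def)
  have "(LINT x:B n|lebesgue. g x) = (\<Sum>i<n. LINT x:A i|lebesgue. g x)" for n
    unfolding B_def using op disj UN
    by (intro set_integral_finite_Union set_integrable_subset[OF int])
       (auto simp: disjoint_family_on_def)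
  then have "(LINT x:B n|lebesgue. g x) \<le> 0" for n
    using le by (simp add: sum_nonpos)
  then show ?thesis
    using LIMSEQ_le_const2[OF lim] by blast
qed

text \<open>
  Adding to \<open>E\<close> every interval that it almost fills makes the components of an open superset
  maximal: a component almost filled by \<open>E\<close> cannot be enlarged and stay so, and hence is a limit
  of intervals to which the hypothesis applies.
\<close>

lemma set_integral_nonpos_from_intervals:
  fixes g :: "real \<Rightarrow> real"
  assumes int: "set_integrable lebesgue {a<..<b} g"
    and E: "E \<in> sets lebesgue" "E \<subseteq> {a<..<b}"
    and not_full: "{a<..<b} - E \<notin> null_sets lebesgue"
    and ivl: "\<And>u v. \<lbrakk>a \<le> u; u < v; v \<le> b; {u<..<v} - E \<notin> null_sets lebesgue\<rbrakk>
                \<Longrightarrow> (LINT x:{u<..<v}|lebesgue. g x) \<le> 0"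
  shows "(LINT x:E|lebesgue. g x) \<le> 0"
proof -
  define full where "full u v \<longleftrightarrow> {u<..<v} - E \<in> null_sets lebesgue" for u v
  \<comment> \<open>Rational endpoints keep the union countable, so that \<open>Z - E\<close> is
    null. By exhaustion from inside, \<open>Z\<close> still contains every interval that
    \<open>E\<close> almost fills.\<close>
  define Z where "Z = (\<Union>(u,v) \<in> {(u,v). u \<in> \<rat> \<and> v \<in> \<rat> \<and> a \<le> u \<and> v \<le> b \<and> full u v}. {u<..<v})"
  have Z_open: "open Z" unfolding Z_def by auto
  have cntQ: "countable {(u,v). u \<in> \<rat> \<and> v \<in> \<rat> \<and> a \<le> u \<and> v \<le> b \<and> full u v}"
    by (rule countable_subset[of _ "\<rat> \<times> \<rat>"]) (auto intro: countable_rat)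
  have Z_null: "Z - E \<in> null_sets lebesgue"
  proof -
    have "Z - E = (\<Union>(u,v) \<in> {(u,v). u \<in> \<rat> \<and> v \<in> \<rat> \<and> a \<le> u \<and> v \<le> b \<and> full u v}. {u<..<v} - E)"
      unfolding Z_def by auto
    also have "\<dots> \<in> null_sets lebesgue"
      using cntQ by (intro null_sets_UN') (auto simp: full_def)
    finally show ?thesis .
  qed
  have full_Z: "{u<..<v} \<subseteq> Z" if "a \<le> u" "v \<le> b" "full u v" for u v
  proof
    fix x assume x: "x \<in> {u<..<v}"
    obtain q where q: "q \<in> \<rat>" "u < q" "q < x" using x Rats_dense_in_real[of u x] by auto
    obtain r where r: "r \<in> \<rat>" "x < r" "r < v" using x Rats_dense_in_real[of x v] by auto
    have "{q<..<r} - E \<in> null_sets lebesgue"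
    proof (rule null_sets_subset)
      show "{u<..<v} - E \<in> null_sets lebesgue" using that(3) by (simp add: full_def)
      show "{q<..<r} - E \<subseteq> {u<..<v} - E" using q r by auto
    qed (use E(1) in auto)
    then have "(q, r) \<in> {(u,v). u \<in> \<rat> \<and> v \<in> \<rat> \<and> a \<le> u \<and> v \<le> b \<and> full u v}"
      using q r that by (simp add: full_def)
    then show "x \<in> Z" unfolding Z_def by (rule UN_I) (use q r in simp)
  qed
  have Z_sub: "Z \<subseteq> {a<..<b}" unfolding Z_def by auto
  have open_le: "(LINT x:G|lebesgue. g x) \<le> 0"
    if G: "open G" "E \<union> Z \<subseteq> G" "G \<subseteq> {a<..<b}" for G
  proof (rule set_integral_open_nonpos[OF G(1)])
    show "set_integrable lebesgue G g"
      using G by (intro set_integrable_subset[OF int]) auto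
    fix C assume C: "C \<in> components G"
    have "open C" "C \<noteq> {}" "connected C" "C \<subseteq> G"
      using C G(1) open_components in_components_nonempty in_components_connected in_components_subset
      by blast+
    moreover have "bounded C"
      using \<open>C \<subseteq> G\<close> G(3) bounded_subset[OF bounded_box] by (metis box_real(1) order_trans)
    ultimately obtain u v where uv: "u < v" "C = {u<..<v}"
      using open_bounded_interval_real is_interval_connected_1 by metis
    have "{u<..<v} \<subseteq> {a<..<b}" using uv \<open>C \<subseteq> G\<close> G(3) by auto
    then have ab: "a \<le> u" "v \<le> b" using uv(1) by (simp_all add: greaterThanLessThan_subseteq_greaterThanLessThan)
    \<comment> \<open>A larger full interval would lie in \<open>Z\<close>, hence in
      \<open>G\<close>, and it meets \<open>C\<close>; this contradicts the maximality of the
      component.\<close>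
    have not_full_bigger: "\<not> full u' v'"
      if "a \<le> u'" "v' \<le> b" "u' \<le> u" "v \<le> v'" "(u', v') \<noteq> (u, v)" for u' v'
    proof
      assume "full u' v'"
      then have "{u'<..<v'} \<subseteq> G" using full_Z that G(2) by blast
      moreover have "(u + v) / 2 \<in> C \<inter> {u'<..<v'}" using uv that by auto
      then have "C \<inter> {u'<..<v'} \<noteq> {}" by blast
      moreover have "connected {u'<..<v'}" by simp
      ultimately have "{u'<..<v'} \<subseteq> {u<..<v}"
        using components_maximal[OF C] uv(2) by metis
      then have "u \<le> u'" "v' \<le> v"
        using that uv(1) by (simp_all add: greaterThanLessThan_subseteq_greaterThanLessThan)
      then show False using that by simp
    qed
    show "(LINT x:C|lebesgue. g x) \<le> 0"
    proof (cases "full u v")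
      case False
      then show ?thesis using ivl[OF ab(1) uv(1) ab(2)] by (simp add: full_def uv(2))
    next
      case True
      \<comment> \<open>\<open>{a<..<b}\<close> itself is not full, so a full component leaves room
        on at least one side.\<close>
      then have "a < u \<or> v < b" using ab not_full by (auto simp: full_def not_less dest: antisym)
      then show ?thesis
      proof
        assume "v < b"
        \<comment> \<open>The right endpoint is pushed out to \<open>w n\<close>, which decreases
          from \<open>w 0 = b\<close> to \<open>v\<close>. Each enlarged interval is not full, so
          \<open>ivl\<close> applies to it; the intersection adds only the point \<open>v\<close> to
          \<open>C\<close>.\<close>
        define w where "w n = v + (b - v) / (real n + 1)" for n
        have w: "v < w n" "w n \<le> b" for n
          using \<open>v < b\<close> by (auto simp: w_def field_simps intro!: mult_right_mono)
        have "w \<longlonglongrightarrow> v" unfolding w_def by real_asymp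
        have le: "(LINT x:{u<..<w n}|lebesgue. g x) \<le> 0" for n
          using not_full_bigger[of u "w n"] w[of n] ab uv(1)
          by (intro ivl) (auto simp: full_def)
        have "decseq w"
          using \<open>v < b\<close> by (auto simp: decseq_def w_def intro!: divide_left_mono)
        have "(\<lambda>n. LINT x:{u<..<w n}|lebesgue. g x) \<longlonglongrightarrow> (LINT x:(\<Inter>n. {u<..<w n})|lebesgue. g x)"
        proof (rule set_integral_cont_down)
          show "decseq (\<lambda>n. {u<..<w n})"
            using decseqD[OF \<open>decseq w\<close>] by (fastforce simp: decseq_def intro: less_le_trans)
          show "set_integrable lebesgue {u<..<w 0} g"
            using ab uv(1) w[of 0] by (intro set_integrable_subset[OF int]) auto
        qed auto
        moreover have "(\<forall>n. x < w n) \<longleftrightarrow> x \<le> v" for x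
          using w(1) LIMSEQ_le_const[OF \<open>w \<longlonglongrightarrow> v\<close>, of x] by (meson le_less_trans less_imp_le)
        then have "(\<Inter>n. {u<..<w n}) = {u<..v}" by (simp add: set_eq_iff)
        ultimately have "(LINT x:{u<..v}|lebesgue. g x) \<le> 0"
          using le by (auto intro: LIMSEQ_le_const2)
        moreover have "(LINT x:{u<..<v}|lebesgue. g x) = (LINT x:{u<..v}|lebesgue. g x)"
          using ab uv(1) \<open>v < b\<close>
          by (intro set_integral_cong_set' set_integrable_subset[OF int] AE_I'[of "{v}"]) auto
        ultimately show ?thesis by (simp add: uv(2))
      next
        assume "a < u"
        \<comment> \<open>The mirror image: the left endpoint moves out to \<open>w n\<close>, which
          increases from \<open>w 0 = a\<close> to \<open>u\<close>.\<close>
        define w where "w n = u - (u - a) / (real n + 1)" for n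
        have w: "w n < u" "a \<le> w n" for n
          using \<open>a < u\<close> by (auto simp: w_def field_simps intro!: mult_right_mono)
        have "w \<longlonglongrightarrow> u" unfolding w_def by real_asymp
        have le: "(LINT x:{w n<..<v}|lebesgue. g x) \<le> 0" for n
          using not_full_bigger[of "w n" v] w[of n] ab uv(1)
          by (intro ivl) (auto simp: full_def)
        have "incseq w"
          using \<open>a < u\<close> by (auto simp: incseq_def w_def intro!: divide_left_mono)
        have "(\<lambda>n. LINT x:{w n<..<v}|lebesgue. g x) \<longlonglongrightarrow> (LINT x:(\<Inter>n. {w n<..<v})|lebesgue. g x)"
        proof (rule set_integral_cont_down)
          show "decseq (\<lambda>n. {w n<..<v})"
            using incseqD[OF \<open>incseq w\<close>] by (fastforce simp: decseq_def intro: le_less_trans)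
          show "set_integrable lebesgue {w 0<..<v} g"
            using ab uv(1) w[of 0] by (intro set_integrable_subset[OF int]) auto
        qed auto
        moreover have "(\<forall>n. w n < x) \<longleftrightarrow> u \<le> x" for x
          using w(1) LIMSEQ_le_const2[OF \<open>w \<longlonglongrightarrow> u\<close>, of x] by (meson less_le_trans less_imp_le)
        then have "(\<Inter>n. {w n<..<v}) = {u..<v}" by (auto simp add: set_eq_iff)
        ultimately have "(LINT x:{u..<v}|lebesgue. g x) \<le> 0"
          using le by (auto intro: LIMSEQ_le_const2)
        moreover have "(LINT x:{u<..<v}|lebesgue. g x) = (LINT x:{u..<v}|lebesgue. g x)"
          using ab uv(1) \<open>a < u\<close>
          by (intro set_integral_cong_set' set_integrable_subset[OF int] AE_I'[of "{u}"]) auto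
        ultimately show ?thesis by (simp add: uv(2))
      qed
    qed
  qed
  have EZ: "E \<union> Z \<in> sets lebesgue" using E(1) Z_open by auto
  have "\<exists>T. open T \<and> E \<union> Z \<subseteq> T \<and> emeasure lebesgue (T - (E \<union> Z)) < ennreal (1 / (real n + 1))" for n
    by (rule sets_lebesgue_outer_open[OF EZ, of "1 / (real n + 1)"]) auto
  then obtain T where T: "\<And>n. open (T n)" "\<And>n. E \<union> Z \<subseteq> T n"
      "\<And>n. emeasure lebesgue (T n - (E \<union> Z)) < ennreal (1 / (real n + 1))" by metis
  \<comment> \<open>The \<open>T n\<close> come from outer regularity. Finite intersections make the
    sequence decreasing, and cutting with \<open>{a<..<b}\<close> makes \<open>open_le\<close>
    applicable to every \<open>G n\<close>.\<close>
  define G where "G n = {a<..<b} \<inter> (\<Inter>i\<le>n. T i)" for n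
  have G: "open (G n)" "E \<union> Z \<subseteq> G n" "G n \<subseteq> {a<..<b}" for n
    using T E(2) Z_sub unfolding G_def by (auto intro!: open_Int open_INT)
  have "decseq G" unfolding G_def decseq_def by fastforce
  have lim: "(\<lambda>n. LINT x:G n|lebesgue. g x) \<longlonglongrightarrow> (LINT x:(\<Inter>n. G n)|lebesgue. g x)"
    using G \<open>decseq G\<close> by (intro set_integral_cont_down set_integrable_subset[OF int]) auto
  have le: "(LINT x:(\<Inter>n. G n)|lebesgue. g x) \<le> 0"
    using LIMSEQ_le_const2[OF lim] open_le[OF G] by blast
  have INT_sets: "(\<Inter>n. G n) \<in> sets lebesgue" using G(1) by auto
  have null: "(\<Inter>n. G n) - (E \<union> Z) \<in> null_sets lebesgue"
  proof -
    have le_n: "emeasure lebesgue ((\<Inter>n. G n) - (E \<union> Z)) \<le> ennreal (1 / (real n + 1))" for n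
    proof -
      have "emeasure lebesgue ((\<Inter>n. G n) - (E \<union> Z)) \<le> emeasure lebesgue (T n - (E \<union> Z))"
        using T(1)[of n] EZ by (intro emeasure_mono) (auto simp: G_def)
      then show ?thesis using T(3)[of n] by order
    qed
    have "(\<lambda>n. ennreal (1 / (real n + 1))) \<longlonglongrightarrow> ennreal 0"
      by (intro tendsto_ennrealI) real_asymp
    then have "emeasure lebesgue ((\<Inter>n. G n) - (E \<union> Z)) \<le> ennreal 0"
      by (rule LIMSEQ_le_const) (use le_n in blast)
    then have "emeasure lebesgue ((\<Inter>n. G n) - (E \<union> Z)) = 0" by simp
    then show ?thesis using INT_sets EZ by (intro null_setsI) auto
  qed
  have "(LINT x:E|lebesgue. g x) = (LINT x:(\<Inter>n. G n)|lebesgue. g x)"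
  proof (rule set_integral_cong_set')
    \<comment> \<open>The limit set exceeds \<open>E\<close> by two null sets: the excess over
      \<open>E \<union> Z\<close>, and the part of \<open>Z\<close> outside
      \<open>E\<close>.\<close>
    have "((\<Inter>n. G n) - (E \<union> Z)) \<union> (Z - E) \<in> null_sets lebesgue"
      using null Z_null by blast
    then show "AE x in lebesgue. x \<in> E \<longleftrightarrow> x \<in> (\<Inter>n. G n)"
      by (rule AE_I') (use G(2) in auto)
    show "set_integrable lebesgue (\<Inter>n. G n) g"
      using G(3) INT_sets by (intro set_integrable_subset[OF int]) auto
    show "set_integrable lebesgue E g"
      using E by (intro set_integrable_subset[OF int]) auto
  qed
  then show ?thesis using le by simp
qed

subsection \<open>From weak-type bounds to powers\<close>

text \<open>The inner integral of the layer-cake argument, with \<open>y\<close> standing for a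
  value of the function. It is used with \<open>q = p - 1\<close> on the left of the weak-type bound
  and with \<open>q = p\<close> on the right.\<close>

lemma nn_integral_powr_between:
  fixes m N y q :: real
  assumes "0 < m" "m \<le> N" "m \<le> y" "0 < q"
  shows "(\<integral>\<^sup>+t. ennreal (indicator {m<..N} t * indicator {..<y} t * t powr (q - 1)) \<partial>lborel)
           = ennreal ((min y N powr q - m powr q) / q)"
proof -
  have "(\<integral>\<^sup>+t. ennreal (indicator {m<..N} t * indicator {..<y} t * t powr (q - 1)) \<partial>lborel)
      = (\<integral>\<^sup>+t. ennreal (t powr (q - 1)) * indicator {m..min y N} t \<partial>lborel)"
  \<comment> \<open>The two domains of integration differ at most at the points \<open>m\<close> and
    \<open>y\<close>.\<close>
  proof (rule nn_integral_cong_AE)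
    show "AE t in lborel. ennreal (indicator {m<..N} t * indicator {..<y} t * t powr (q - 1))
        = ennreal (t powr (q - 1)) * indicator {m..min y N} t"
      using AE_lborel_singleton[of m] AE_lborel_singleton[of y]
      by eventually_elim (auto simp: indicator_def)
  qed
  also have "\<dots> = ennreal (min y N powr q / q - m powr q / q)"
  proof (rule nn_integral_FTC_Icc)
    fix t assume "t \<in> {m..min y N}"
    then have "t > 0" using \<open>0 < m\<close> by auto
    then show "DERIV (\<lambda>t. t powr q / q) t :> t powr (q - 1)"
      using \<open>0 < q\<close> by (auto intro!: derivative_eq_intros)
  qed (use assms in auto)
  finally show ?thesis by (simp add: diff_divide_distrib)
qed

context finite_measure
begin

text \<open>
  Integrating the weak-type bound against \<open>t powr (p - 2)\<close> over \<open>m < t \<le> N\<close>; the truncation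
  at \<open>N\<close> keeps all integrals finite.
\<close>

lemma weak_type_layer_cake:
  fixes f :: "'a \<Rightarrow> real" and c m p N :: real
  assumes f: "integrable M f" and "0 < m" and ge: "AE x in M. m \<le> f x" and "1 < p" and "0 \<le> c"
    and weak: "\<And>t. m < t \<Longrightarrow>
      (\<integral>x. indicator {t<..} (f x) * f x \<partial>M) \<le> c * t * measure M {x \<in> space M. t < f x}"
    and "m \<le> N"
  shows "(\<integral>x. f x * (min (f x) N powr (p - 1) - m powr (p - 1)) / (p - 1) \<partial>M)
           \<le> (\<integral>x. c * (min (f x) N powr p - m powr p) / p \<partial>M)" (is "(\<integral>x. ?a x \<partial>M) \<le> (\<integral>x. ?b x \<partial>M)")
    and "integrable M (\<lambda>x. f x * (min (f x) N powr (p - 1) - m powr (p - 1)) / (p - 1))"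
proof -
  have [measurable]: "f \<in> borel_measurable M" using f by auto
  have "0 < N" using \<open>0 < m\<close> \<open>m \<le> N\<close> by linarith
  interpret P: pair_sigma_finite M lborel
    by (intro pair_sigma_finite.intro sigma_finite_measure_axioms sigma_finite_lborel)
  \<comment> \<open>Integrated over \<open>t\<close>, \<open>h1 x\<close> and \<open>h2 x\<close>
    give the two integrands of the claim. Values in the extended nonnegative reals make joint
    measurability enough for exchanging the integrals. The exponent of \<open>h2\<close> is larger
    by one because of the factor \<open>t\<close> in the weak-type bound.\<close>
  define h1 where "h1 x t = ennreal (f x) *
    ennreal (indicator {m<..N} t * indicator {..<f x} t * t powr ((p - 1) - 1))" for x t
  define h2 where "h2 x t = ennreal c *
    ennreal (indicator {m<..N} t * indicator {..<f x} t * t powr (p - 1))" for x t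
  \<comment> \<open>As the indicator of a set in the product space, the dependence on both variables
    becomes visible to the measurability prover.\<close>
  have ind: "indicator {..<f x} t = indicator {z. snd z < f (fst z)} (x, t)" for x t
    by (simp add: indicator_def)
  have meas1: "(\<lambda>(x, t). h1 x t) \<in> borel_measurable (M \<Otimes>\<^sub>M lborel)"
    unfolding h1_def ind by measurable
  have meas2: "(\<lambda>(x, t). h2 x t) \<in> borel_measurable (M \<Otimes>\<^sub>M lborel)"
    unfolding h2_def ind by measurable
  \<comment> \<open>For \<open>t\<close> in \<open>{m<..N}\<close> this is the weak-type bound
    multiplied by \<open>t powr (p - 2)\<close>; elsewhere the left-hand side vanishes.\<close>
  have slice: "(\<integral>\<^sup>+x. h1 x t \<partial>M) \<le> (\<integral>\<^sup>+x. h2 x t \<partial>M)" for t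
  proof (cases "t \<in> {m<..N}")
    case False
    then show ?thesis by (simp add: h1_def)
  next
    case True
    then have "0 < t" using \<open>0 < m\<close> by auto
    have int: "integrable M (\<lambda>x. indicator {t<..} (f x) * f x)"
      by (rule Bochner_Integration.integrable_bound[OF f]) (auto simp: indicator_def)
    have nn: "(\<integral>\<^sup>+x. ennreal (indicator {t<..} (f x) * f x) \<partial>M)
        = ennreal (\<integral>x. indicator {t<..} (f x) * f x \<partial>M)"
      by (rule nn_integral_eq_integral[OF int]) (use \<open>0 < t\<close> in \<open>auto simp: indicator_def\<close>)
    have "(\<integral>\<^sup>+x. h1 x t \<partial>M)
        = (\<integral>\<^sup>+x. ennreal (t powr (p - 2)) * ennreal (indicator {t<..} (f x) * f x) \<partial>M)"
      using True \<open>0 < t\<close>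
      by (intro nn_integral_cong) (auto simp: h1_def indicator_def mult.commute)
    also have "\<dots> = ennreal (t powr (p - 2)) * ennreal (\<integral>x. indicator {t<..} (f x) * f x \<partial>M)"
      by (subst nn_integral_cmult) (auto simp: nn)
    also have "\<dots> \<le> ennreal (t powr (p - 2)) * ennreal (c * t * measure M {x \<in> space M. t < f x})"
      using weak True by (intro mult_left_mono ennreal_leI) auto
    also have "\<dots> = ennreal (c * t powr (p - 1)) * emeasure M {x \<in> space M. t < f x}"
    proof -
      have "t powr (p - 2) * t = t powr (p - 1)"
        using \<open>0 < t\<close> powr_mult_base[of t "p - 2"] by (simp add: mult.commute)
      then have "t powr (p - 2) * (c * t * k) = c * t powr (p - 1) * k" for k
        by (metis mult.assoc mult.commute)
      then show ?thesis
        using \<open>0 < t\<close> \<open>0 \<le> c\<close> by (simp add: emeasure_eq_measure ennreal_mult[symmetric])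
    qed
    also have "\<dots> = (\<integral>\<^sup>+x. ennreal (c * t powr (p - 1)) * indicator {x \<in> space M. t < f x} x \<partial>M)"
      by (simp add: nn_integral_cmult_indicator)
    also have "\<dots> = (\<integral>\<^sup>+x. h2 x t \<partial>M)"
      using True \<open>0 \<le> c\<close>
      by (intro nn_integral_cong) (auto simp: h2_def indicator_def ennreal_mult)
    finally show ?thesis .
  qed
  have a: "(\<integral>\<^sup>+t. h1 x t \<partial>lborel) = ennreal (?a x)" and a0: "0 \<le> ?a x" if "m \<le> f x" for x
  proof -
    have "m powr (p - 1) \<le> min (f x) N powr (p - 1)"
      using that \<open>m \<le> N\<close> \<open>0 < m\<close> \<open>1 < p\<close> by (intro powr_mono2) auto
    then show "0 \<le> ?a x" using that \<open>0 < m\<close> \<open>1 < p\<close> by simp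
    show "(\<integral>\<^sup>+t. h1 x t \<partial>lborel) = ennreal (?a x)"
      unfolding h1_def using that \<open>m \<le> N\<close> \<open>0 < m\<close> \<open>1 < p\<close> \<open>_ \<le> min (f x) N powr _\<close>
      by (subst nn_integral_cmult, measurable, subst nn_integral_powr_between)
         (auto simp: ennreal_mult[symmetric])
  qed
  have b: "(\<integral>\<^sup>+t. h2 x t \<partial>lborel) = ennreal (?b x)" and b0: "0 \<le> ?b x" if "m \<le> f x" for x
  proof -
    have "m powr p \<le> min (f x) N powr p"
      using that \<open>m \<le> N\<close> \<open>0 < m\<close> \<open>1 < p\<close> by (intro powr_mono2) auto
    then show "0 \<le> ?b x" using \<open>0 \<le> c\<close> \<open>1 < p\<close> by simp
    show "(\<integral>\<^sup>+t. h2 x t \<partial>lborel) = ennreal (?b x)"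
      unfolding h2_def using that \<open>m \<le> N\<close> \<open>0 < m\<close> \<open>1 < p\<close> \<open>0 \<le> c\<close> \<open>_ \<le> min (f x) N powr _\<close>
      by (subst nn_integral_cmult, measurable, subst nn_integral_powr_between)
         (auto simp: ennreal_mult[symmetric])
  qed
  have bound: "m powr q \<le> min (f x) N powr q \<and> min (f x) N powr q \<le> N powr q"
    if "m \<le> f x" "0 < q" for x q
    using that \<open>0 < m\<close> \<open>m \<le> N\<close> by (auto intro!: powr_mono2)
  show int_a: "integrable M ?a"
  proof (rule Bochner_Integration.integrable_bound)
    \<comment> \<open>The truncation at \<open>N\<close> bounds the power by a constant, so a
      multiple of \<open>f\<close> dominates.\<close>
    show "integrable M (\<lambda>x. N powr (p - 1) / (p - 1) * f x)" using f by simp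
    show "AE x in M. norm (?a x) \<le> norm (N powr (p - 1) / (p - 1) * f x)"
      using ge
    proof eventually_elim
      case (elim x)
      have "min (f x) N powr (p - 1) - m powr (p - 1) \<le> N powr (p - 1)"
        using bound[OF elim, of "p - 1"] \<open>1 < p\<close> powr_ge_zero[of m "p - 1"] by linarith
      then have "?a x \<le> f x * N powr (p - 1) / (p - 1)"
        using elim \<open>0 < m\<close> \<open>1 < p\<close> by (intro divide_right_mono mult_left_mono) auto
      then show ?case using a0[OF elim] elim \<open>0 < m\<close> \<open>1 < p\<close> by (simp add: mult.commute)
    qed
  qed measurable
  have int_b: "integrable M ?b"
  proof (rule integrable_const_bound[where B = "c * N powr p / p"])
    show "AE x in M. norm (?b x) \<le> c * N powr p / p"
      using ge
    proof eventually_elim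
      case (elim x)
      have "min (f x) N powr p - m powr p \<le> N powr p"
        using bound[OF elim, of p] \<open>1 < p\<close> powr_ge_zero[of m p] by linarith
      then have "?b x \<le> c * N powr p / p"
        using \<open>0 \<le> c\<close> \<open>1 < p\<close> by (intro divide_right_mono mult_left_mono) auto
      then show ?case using b0[OF elim] by (simp only: real_norm_def abs_of_nonneg)
    qed
  qed measurable
  have "ennreal (\<integral>x. ?a x \<partial>M) = (\<integral>\<^sup>+x. ennreal (?a x) \<partial>M)"
    using ge by (intro nn_integral_eq_integral[OF int_a, symmetric]) (auto elim!: eventually_mono intro: a0)
  also have "\<dots> = (\<integral>\<^sup>+x. \<integral>\<^sup>+t. h1 x t \<partial>lborel \<partial>M)"
    using ge by (intro nn_integral_cong_AE) (auto elim!: eventually_mono simp: a)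
  also have "\<dots> = (\<integral>\<^sup>+t. \<integral>\<^sup>+x. h1 x t \<partial>M \<partial>lborel)"
    using P.Fubini'[OF meas1] by simp
  also have "\<dots> \<le> (\<integral>\<^sup>+t. \<integral>\<^sup>+x. h2 x t \<partial>M \<partial>lborel)"
    by (intro nn_integral_mono slice)
  also have "\<dots> = (\<integral>\<^sup>+x. \<integral>\<^sup>+t. h2 x t \<partial>lborel \<partial>M)"
    using P.Fubini'[OF meas2] by simp
  also have "\<dots> = (\<integral>\<^sup>+x. ennreal (?b x) \<partial>M)"
    using ge by (intro nn_integral_cong_AE) (auto elim!: eventually_mono simp: b)
  also have "\<dots> = ennreal (\<integral>x. ?b x \<partial>M)"
    using ge by (intro nn_integral_eq_integral[OF int_b]) (auto elim!: eventually_mono intro: b0)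
  finally show "(\<integral>x. ?a x \<partial>M) \<le> (\<integral>x. ?b x \<partial>M)"
  proof (subst (asm) ennreal_le_iff)
    show "0 \<le> (\<integral>x. ?b x \<partial>M)"
      using ge by (intro integral_nonneg_AE) (auto elim!: eventually_mono intro: b0)
  qed
qed

text \<open>With \<open>u = min (f x) N\<close>, the inequality
  \<open>u powr p \<le> f x * u powr (p - 1)\<close> puts the integral of \<open>u powr p\<close> on
  both sides of the layer-cake bound. As it is finite, it can be moved to the left; after
  multiplication by \<open>p * (p - 1)\<close> its coefficient is
  \<open>p - c * (p - 1)\<close>.\<close>

lemma weak_type_imp_truncated_powr_bound:
  fixes f :: "'a \<Rightarrow> real" and c m p N :: real
  assumes f: "integrable M f" and "0 < m" and ge: "AE x in M. m \<le> f x" and "1 < p" and "0 \<le> c"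
    and weak: "\<And>t. m < t \<Longrightarrow>
      (\<integral>x. indicator {t<..} (f x) * f x \<partial>M) \<le> c * t * measure M {x \<in> space M. t < f x}"
    and "m \<le> N"
  shows "integrable M (\<lambda>x. min (f x) N powr p)"
    and "(c + p - p * c) * (\<integral>x. min (f x) N powr p \<partial>M)
           \<le> p * m powr (p - 1) * (\<integral>x. f x \<partial>M) - c * (p - 1) * m powr p * measure M (space M)"
proof -
  have [measurable]: "f \<in> borel_measurable M" using f by auto
  let ?u = "\<integral>x. min (f x) N powr p \<partial>M"
  show int_u: "integrable M (\<lambda>x. min (f x) N powr p)"
  proof (rule integrable_const_bound[where B = "N powr p"])
    show "AE x in M. norm (min (f x) N powr p) \<le> N powr p"
      using ge
      by eventually_elim (use \<open>0 < m\<close> \<open>m \<le> N\<close> \<open>1 < p\<close> in \<open>auto intro!: powr_mono2\<close>)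
  qed measurable
  have "(?u - m powr (p - 1) * (\<integral>x. f x \<partial>M)) / (p - 1)
      = (\<integral>x. (min (f x) N powr p - m powr (p - 1) * f x) / (p - 1) \<partial>M)"
    using int_u f by simp
  also have "\<dots> \<le> (\<integral>x. f x * (min (f x) N powr (p - 1) - m powr (p - 1)) / (p - 1) \<partial>M)"
  proof (rule integral_mono_AE)
    show "AE x in M. (min (f x) N powr p - m powr (p - 1) * f x) / (p - 1)
        \<le> f x * (min (f x) N powr (p - 1) - m powr (p - 1)) / (p - 1)"
      using ge
    proof eventually_elim
      case (elim x)
      then have "0 < min (f x) N" using \<open>0 < m\<close> \<open>m \<le> N\<close> by linarith
      then have "min (f x) N powr p = min (f x) N * min (f x) N powr (p - 1)"
        by (simp add: powr_mult_base)
      also have "\<dots> \<le> f x * min (f x) N powr (p - 1)"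
        by (intro mult_right_mono) auto
      finally show ?case using \<open>1 < p\<close> by (intro divide_right_mono) (auto simp: algebra_simps)
    qed
  qed (use int_u f weak_type_layer_cake(2)[OF assms] in auto)
  also have "\<dots> \<le> (\<integral>x. c * (min (f x) N powr p - m powr p) / p \<partial>M)"
    by (rule weak_type_layer_cake(1)[OF assms])
  also have "\<dots> = c * (?u - m powr p * measure M (space M)) / p"
    using int_u by simp
  finally show "(c + p - p * c) * ?u
           \<le> p * m powr (p - 1) * (\<integral>x. f x \<partial>M) - c * (p - 1) * m powr p * measure M (space M)"
    using \<open>1 < p\<close> by (simp add: field_simps)
qed

text \<open>Since the coefficient is positive, the truncated integrals are bounded independently of
  the truncation level, and monotone convergence gives both integrability and the bound.\<close>

lemma weak_type_imp_powr_bound: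
  fixes f :: "'a \<Rightarrow> real" and c m p :: real
  assumes f: "integrable M f" and "0 < m" and ge: "AE x in M. m \<le> f x" and "1 < p" and "0 \<le> c"
    and weak: "\<And>t. m < t \<Longrightarrow>
      (\<integral>x. indicator {t<..} (f x) * f x \<partial>M) \<le> c * t * measure M {x \<in> space M. t < f x}"
    and pos: "0 < c + p - p * c"
  shows "integrable M (\<lambda>x. f x powr p)"
    and "(c + p - p * c) * (\<integral>x. f x powr p \<partial>M)
           \<le> p * m powr (p - 1) * (\<integral>x. f x \<partial>M) - c * (p - 1) * m powr p * measure M (space M)"
      (is "_ \<le> ?R")
proof -
  have [measurable]: "f \<in> borel_measurable M" using f by auto
  \<comment> \<open>Levels starting at \<open>m\<close> satisfy the requirement
    \<open>m \<le> N\<close> for every \<open>n\<close>.\<close>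
  define F where "F n x = min (f x) (m + real n) powr p" for n x
  have int_F: "integrable M (F n)" for n
    unfolding F_def using weak_type_imp_truncated_powr_bound(1)[OF assms(1-6), of "m + real n"] by simp
  have bound: "(\<integral>x. F n x \<partial>M) \<le> ?R / (c + p - p * c)" for n
    using weak_type_imp_truncated_powr_bound(2)[OF assms(1-6), of "m + real n"] pos
    by (simp add: F_def pos_le_divide_eq mult.commute)
  have mono_F: "F n x \<le> F k x" if "n \<le> k" "m \<le> f x" for n k x
    unfolding F_def using that \<open>0 < m\<close> \<open>1 < p\<close> by (intro powr_mono2) auto
  have "incseq (\<lambda>n. \<integral>x. F n x \<partial>M)"
    unfolding incseq_def
    using ge by (intro allI impI integral_mono_AE int_F) (auto elim!: eventually_mono intro: mono_F)
  then obtain L where L: "(\<lambda>n. \<integral>x. F n x \<partial>M) \<longlonglongrightarrow> L"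
    using incseq_convergent bound by blast
  have lim: "AE x in M. (\<lambda>n. F n x) \<longlonglongrightarrow> f x powr p"
  proof (intro AE_I2 tendsto_eventually)
    fix x
    show "eventually (\<lambda>n. F n x = f x powr p) sequentially"
      using eventually_ge_at_top[of "nat \<lceil>f x - m\<rceil>"]
    proof eventually_elim
      case (elim n)
      then have "f x \<le> m + real n" by linarith
      then show ?case by (simp add: F_def)
    qed
  qed
  have mono: "AE x in M. mono (\<lambda>n. F n x)"
    using ge by eventually_elim (auto simp: mono_def intro: mono_F)
  show "integrable M (\<lambda>x. f x powr p)"
    by (rule integrable_monotone_convergence[OF int_F mono lim L]) measurable
  have "(\<integral>x. f x powr p \<partial>M) = L"
    by (rule integral_monotone_convergence[OF int_F mono lim L]) measurable
  moreover have "L \<le> ?R / (c + p - p * c)"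
    using LIMSEQ_le_const2[OF L] bound by blast
  ultimately show "(c + p - p * c) * (\<integral>x. f x powr p \<partial>M) \<le> ?R"
    using pos by (simp add: pos_le_divide_eq mult.commute)
qed

end

subsection \<open>The \<open>A\<^sub>1\<close> condition\<close>

text \<open>\<open>Sup\<close> on the reals is meaningful only for bounded sets. A real-valued
  function cannot exceed every natural number at any point, so arbitrarily large lower bounds would
  force \<open>I\<close> to be null.\<close>

lemma ess_inf_on_bdd_above:
  fixes f :: "real \<Rightarrow> real"
  assumes "I \<in> sets lebesgue" "I \<notin> null_sets lebesgue"
  shows "bdd_above {a. AE x in lebesgue. x \<in> I \<longrightarrow> a \<le> f x}"
proof (rule ccontr)
  assume "\<not> bdd_above {a. AE x in lebesgue. x \<in> I \<longrightarrow> a \<le> f x}"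
  then have unbdd: "\<exists>a. (AE x in lebesgue. x \<in> I \<longrightarrow> a \<le> f x) \<and> y < a" for y
    by (auto simp: bdd_above_def not_le)
  have "AE x in lebesgue. x \<in> I \<longrightarrow> real n \<le> f x" for n
  proof -
    obtain a where "AE x in lebesgue. x \<in> I \<longrightarrow> a \<le> f x" "real n < a"
      using unbdd by blast
    then show ?thesis by (auto elim!: eventually_mono)
  qed
  then have "AE x in lebesgue. \<forall>n. x \<in> I \<longrightarrow> real n \<le> f x"
    by (intro AE_all_countable[THEN iffD2] allI)
  then have "AE x in lebesgue. x \<notin> I"
  proof eventually_elim
    case (elim x)
    obtain n where "f x < real n" using reals_Archimedean2 by blast
    then show ?case using elim[rule_format, of n] by auto
  qed
  then show False using assms AE_iff_null_sets by blast
qed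

lemma ess_inf_on_greatest:
  assumes "I \<in> sets lebesgue" "I \<notin> null_sets lebesgue"
    and "AE x in lebesgue. x \<in> I \<longrightarrow> a \<le> f x"
  shows "a \<le> ess_inf_on I f"
  unfolding ess_inf_on_def using assms by (intro cSup_upper ess_inf_on_bdd_above) auto

text \<open>The supremum is itself an almost-everywhere lower bound: it is approached along
  \<open>1 / (n + 1)\<close>, and only countably many null sets are discarded. The hypothesis makes
  the set of lower bounds nonempty.\<close>

lemma AE_ess_inf_on_le:
  assumes "AE x in lebesgue. x \<in> I \<longrightarrow> a \<le> f x"
  shows "AE x in lebesgue. x \<in> I \<longrightarrow> ess_inf_on I f \<le> f x"
proof -
  have "AE x in lebesgue. x \<in> I \<longrightarrow> ess_inf_on I f - 1 / (real n + 1) \<le> f x" for n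
  proof -
    have "\<exists>a\<in>{a. AE x in lebesgue. x \<in> I \<longrightarrow> a \<le> f x}. ess_inf_on I f - 1 / (real n + 1) < a"
      unfolding ess_inf_on_def using assms by (intro less_cSupD) auto
    then obtain a' where "AE x in lebesgue. x \<in> I \<longrightarrow> a' \<le> f x" "ess_inf_on I f - 1 / (real n + 1) < a'"
      by blast
    then show ?thesis by (auto elim!: eventually_mono)
  qed
  then have "AE x in lebesgue. \<forall>n. x \<in> I \<longrightarrow> ess_inf_on I f - 1 / (real n + 1) \<le> f x"
    by (intro AE_all_countable[THEN iffD2] allI)
  then show ?thesis
  proof eventually_elim
    case (elim x)
    have lim: "(\<lambda>n. e - 1 / (real n + 1)) \<longlonglongrightarrow> e" for e :: real by real_asymp
    show ?case using elim by (auto intro: LIMSEQ_le_const2[OF lim])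
  qed
qed

lemma subinterval_sets:
  assumes "subinterval I J"
  shows "I \<in> sets lebesgue" "I \<notin> null_sets lebesgue"
proof -
  show "I \<in> sets lebesgue"
    using assms real_interval_borel_measurable by (auto simp: subinterval_def)
  show "I \<notin> null_sets lebesgue"
    using assms by (auto simp: subinterval_def measure_eq_0_null_sets)
qed

text \<open>Positive measure excludes one-point intervals, whence \<open>u < v\<close>.\<close>

lemma subinterval_between:
  assumes "subinterval I {a<..<b}"
  obtains u v where "a \<le> u" "u < v" "v \<le> b" "{u<..<v} \<subseteq> I" "I \<subseteq> {u..v}"
proof -
  have "I \<noteq> {}" using assms by (auto simp: subinterval_def)
  moreover have "bounded I"
    using assms bounded_subset[OF bounded_box] unfolding subinterval_def by (metis box_real(1))
  ultimately obtain u v where uv: "{u<..<v} \<subseteq> I" "I \<subseteq> {u..v}"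
    using assms bounded_interval_between unfolding subinterval_def by blast
  have "u < v"
  proof (rule ccontr)
    assume "\<not> u < v"
    then have "I \<subseteq> {u}" using uv(2) by auto
    then have "I \<in> null_sets lebesgue"
      using subinterval_sets(1)[OF assms] null_sets_subset[of "{u}" lebesgue I] by auto
    then show False using subinterval_sets(2)[OF assms] by blast
  qed
  moreover have "{u<..<v} \<subseteq> {a<..<b}" using uv(1) assms by (auto simp: subinterval_def)
  ultimately have "a \<le> u" "v \<le> b"
    by (simp_all add: greaterThanLessThan_subseteq_greaterThanLessThan)
  then show ?thesis using uv \<open>u < v\<close> that by blast
qed

lemma subinterval_Ioo:
  assumes "a \<le> u" "u < v" "v \<le> b"
  shows "subinterval {u<..<v} {a<..<b}"
  using assms by (auto simp: subinterval_def is_interval_1)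

lemma AE_Ioo_iff_between:
  fixes u v :: real
  assumes "{u<..<v} \<subseteq> I" "I \<subseteq> {u..v}"
  shows "AE x in lebesgue. x \<in> I \<longleftrightarrow> x \<in> {u<..<v}"
  by (rule AE_I'[of "{u, v}"]) (use assms in \<open>auto simp: less_le\<close>)

lemma measure_between:
  fixes u v :: real
  assumes "{u<..<v} \<subseteq> I" "I \<subseteq> {u..v}" "I \<in> sets lebesgue" "u \<le> v"
  shows "measure lebesgue I = v - u"
proof -
  have "measure lebesgue I = measure lebesgue {u<..<v}"
    using AE_Ioo_iff_between[OF assms(1,2)] assms(3) by (intro measure_eq_AE) auto
  then show ?thesis using assms(4) by simp
qed

lemma ess_inf_on_nonneg:
  assumes "subinterval I J" "\<And>x. x \<in> J \<Longrightarrow> 0 \<le> f x"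
  shows "0 \<le> ess_inf_on I f"
  using assms by (intro ess_inf_on_greatest subinterval_sets AE_I2) (auto simp: subinterval_def)

text \<open>The infimum of the admissible constants is attained: on each interval the condition is a
  closed lower bound on the constant if the essential infimum is positive, and does not involve the
  constant if it is 0.\<close>

lemma A1_cond_A1_const:
  assumes "A1_cond J \<phi> c'"
  shows "A1_cond J \<phi> (A1_const J \<phi>)"
proof -
  let ?S = "{c. A1_cond J \<phi> c}"
  have ne: "?S \<noteq> {}" using assms by auto
  have "1 \<le> Inf ?S" using ne by (intro cInf_greatest) (auto simp: A1_cond_def)
  moreover have "avg I \<phi> \<le> Inf ?S * ess_inf_on I \<phi>" if I: "subinterval I J" for I
  proof -
    have "0 \<le> ess_inf_on I \<phi>"
      using ess_inf_on_nonneg[OF I] assms by (auto simp: A1_cond_def intro: less_imp_le)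
    then consider "ess_inf_on I \<phi> = 0" | "0 < ess_inf_on I \<phi>" by linarith
    then show ?thesis
    proof cases
      case 1
      then show ?thesis using assms I by (auto simp: A1_cond_def)
    next
      case 2
      then have "avg I \<phi> / ess_inf_on I \<phi> \<le> Inf ?S"
        using ne I by (intro cInf_greatest) (auto simp: A1_cond_def pos_divide_le_eq)
      then show ?thesis using 2 by (simp add: pos_divide_le_eq)
    qed
  qed
  ultimately show ?thesis using assms by (auto simp: A1_cond_def A1_const_def)
qed

section \<open>The weak-type bound on level sets\<close>

lemma A1_cond_set_integrable_Ioo:
  assumes "A1_cond {a<..<b} \<phi> c" "a \<le> u" "u < v" "v \<le> b"
  shows "set_integrable lebesgue {u<..<v} \<phi>"
  using assms subinterval_Ioo by (auto simp: A1_cond_def)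

text \<open>An interval not almost contained in \<open>E\<close> has essential infimum at most
  \<open>t\<close>, so its average is at most \<open>c * t\<close>. Thus
  \<open>\<phi> - c * t\<close> has nonpositive integral over all such intervals, and the passage
  from intervals to measurable sets applies to it.\<close>

lemma A1_cond_weak_type:
  assumes A1: "A1_cond {a<..<b} \<phi> c" and "a < b" and t: "ess_inf_on {a<..<b} \<phi> < t"
  defines "E \<equiv> {x \<in> {a<..<b}. t < \<phi> x}"
  shows "E \<in> sets lebesgue" "(LINT x:E|lebesgue. \<phi> x) \<le> c * t * measure lebesgue E"
proof -
  have int: "set_integrable lebesgue {a<..<b} \<phi>"
    using A1_cond_set_integrable_Ioo[OF A1] \<open>a < b\<close> by simp
  have "E = \<phi> -` {t<..} \<inter> {a<..<b}" by (auto simp: E_def)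
  then show E: "E \<in> sets lebesgue"
    using int set_borel_measurable_sets[of lebesgue "{a<..<b}" \<phi> "{t<..}"]
    by (auto simp: set_borel_measurable_def set_integrable_def dest!: borel_measurable_integrable)
  have E_sub: "E \<subseteq> {a<..<b}" by (auto simp: E_def)
  \<comment> \<open>As \<open>t\<close> exceeds the essential infimum on \<open>{a<..<b}\<close>,
    this shows that \<open>E\<close> does not almost fill the whole interval.\<close>
  have full_le: "t \<le> ess_inf_on {u<..<v} \<phi>"
    if "a \<le> u" "u < v" "v \<le> b" "{u<..<v} - E \<in> null_sets lebesgue" for u v
  proof (rule ess_inf_on_greatest)
    show "AE x in lebesgue. x \<in> {u<..<v} \<longrightarrow> t \<le> \<phi> x"
      by (rule AE_I'[OF that(4)]) (use that in \<open>auto simp: E_def\<close>)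
  qed (use subinterval_sets[OF subinterval_Ioo, of a u v b] that in auto)
  let ?g = "\<lambda>x. \<phi> x - c * t"
  have fin: "set_integrable lebesgue S (\<lambda>x. c * t)" "(LINT x:S|lebesgue. c * t) = c * t * measure lebesgue S"
    if "S \<in> sets lebesgue" "S \<subseteq> {a<..<b}" for S
  proof -
    have "S \<in> lmeasurable"
      using that bounded_set_imp_lmeasurable bounded_subset[OF bounded_box] by (metis box_real(1))
    then show "set_integrable lebesgue S (\<lambda>x. c * t)" "(LINT x:S|lebesgue. c * t) = c * t * measure lebesgue S"
      by (auto simp: set_integrable_def set_lebesgue_integral_def fmeasurable_def mult.commute)
  qed
  have g: "(LINT x:S|lebesgue. ?g x) = (LINT x:S|lebesgue. \<phi> x) - c * t * measure lebesgue S"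
    if "S \<in> sets lebesgue" "S \<subseteq> {a<..<b}" for S
    using fin[OF that] set_integrable_subset[OF int that] by (subst set_integral_diff(2)) auto
  have "(LINT x:E|lebesgue. ?g x) \<le> 0"
  proof (rule set_integral_nonpos_from_intervals[OF _ E E_sub])
    show "set_integrable lebesgue {a<..<b} ?g"
      using int fin(1)[of "{a<..<b}"] by (intro set_integral_diff) auto
    show "{a<..<b} - E \<notin> null_sets lebesgue"
      using full_le[of a b] \<open>a < b\<close> t by auto
  next
    fix u v assume uv: "a \<le> u" "u < v" "v \<le> b" and not_full: "{u<..<v} - E \<notin> null_sets lebesgue"
    have I: "subinterval {u<..<v} {a<..<b}" using uv by (rule subinterval_Ioo)
    \<comment> \<open>A larger essential infimum would put almost every point of the interval into
      \<open>E\<close>.\<close>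
    have "ess_inf_on {u<..<v} \<phi> \<le> t"
    proof (rule ccontr)
      assume "\<not> ess_inf_on {u<..<v} \<phi> \<le> t"
      moreover have "AE x in lebesgue. x \<in> {u<..<v} \<longrightarrow> ess_inf_on {u<..<v} \<phi> \<le> \<phi> x"
        using A1 uv by (intro AE_ess_inf_on_le[of _ 0] AE_I2) (auto simp: A1_cond_def less_imp_le)
      ultimately have "AE x in lebesgue. x \<notin> {u<..<v} - E"
        using uv by (auto elim!: eventually_mono simp: E_def)
      moreover have "{u<..<v} - E \<in> sets lebesgue" using E by auto
      ultimately show False using not_full AE_iff_null_sets by blast
    qed
    then have "c * ess_inf_on {u<..<v} \<phi> \<le> c * t"
      using A1 by (intro mult_left_mono) (auto simp: A1_cond_def)
    moreover have "avg {u<..<v} \<phi> \<le> c * ess_inf_on {u<..<v} \<phi>"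
      using A1 I by (auto simp: A1_cond_def)
    ultimately have "avg {u<..<v} \<phi> \<le> c * t" by linarith
    then have "(LINT x:{u<..<v}|lebesgue. \<phi> x) \<le> c * t * (v - u)"
      using uv by (simp add: avg_def pos_divide_le_eq)
    then show "(LINT x:{u<..<v}|lebesgue. ?g x) \<le> 0"
      using uv by (subst g) (auto simp: greaterThanLessThan_subseteq_greaterThanLessThan)
  qed
  then show "(LINT x:E|lebesgue. \<phi> x) \<le> c * t * measure lebesgue E"
    using g[OF E E_sub] by simp
qed

section \<open>Optimisation in the essential infimum and the integral inequality for powers\<close>

lemma Bernoulli_powr:
  fixes z p :: real
  assumes "0 < z" "1 \<le> p"
  shows "p * z - (p - 1) \<le> z powr p"
proof -
  \<comment> \<open>Young's inequality for \<open>z powr p\<close> and 1 with weights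
    \<open>1 / p\<close> and \<open>1 - 1 / p\<close>.\<close>
  have "(z powr p) powr (1 / p) * 1 powr (1 - 1 / p) \<le> 1 / p * z powr p + (1 - 1 / p) * 1"
    using assms by (intro Youngs_inequality_0) auto
  then have "p * z \<le> p * (1 / p * z powr p + (1 - 1 / p))"
    using assms by (intro mult_left_mono) (auto simp: powr_powr)
  also have "\<dots> = z powr p + (p - 1)"
    using assms by (simp add: algebra_simps)
  finally show ?thesis by simp
qed

text \<open>
  As a function of the essential infimum \<open>m\<close>, the bound from the layer-cake argument is maximal
  at \<open>m = A / c\<close>.
\<close>

lemma powr_bound_maximum:
  fixes c m p A :: real
  assumes "0 < c" "0 < m" "0 < A" "1 \<le> p"
  shows "p * m powr (p - 1) * A - c * (p - 1) * m powr p \<le> A powr p / c powr (p - 1)"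
proof -
  \<comment> \<open>\<open>z = 1\<close> corresponds to the maximum point \<open>m = A / c\<close>,
    where Bernoulli's inequality is an equality.\<close>
  define z where "z = A / (c * m)"
  have "0 < z" and A: "A = z * (c * m)" using assms by (auto simp: z_def)
  have mp: "m powr p = m * m powr (p - 1)" and cp: "c powr p = c * c powr (p - 1)"
    using assms by (simp_all add: powr_mult_base)
  have "p * m powr (p - 1) * A - c * (p - 1) * m powr p = c * m powr p * (p * z - (p - 1))"
    by (simp add: A mp algebra_simps)
  also have "\<dots> \<le> c * m powr p * z powr p"
    using assms \<open>0 < z\<close> by (intro mult_left_mono Bernoulli_powr) auto
  also have "\<dots> = A powr p / c powr (p - 1)"
    using assms \<open>0 < z\<close> by (simp add: A powr_mult cp field_simps)
  finally show ?thesis .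
qed

text \<open>The range of \<open>p\<close> enters here: for \<open>1 < c\<close>, the condition
  \<open>p < c / (c - 1)\<close> is equivalent to positivity of the coefficient.\<close>

lemma exponent_denominator_pos:
  fixes c p :: real
  assumes "1 < c" "p < c / (c - 1)"
  shows "0 < c + p - p * c"
  using assms by (simp add: field_simps)

text \<open>A nonnegative integrand with integral 0 vanishes almost everywhere, which would make
  \<open>I\<close> null.\<close>

lemma avg_pos:
  assumes "set_integrable lebesgue I f" "I \<in> sets lebesgue" "0 < measure lebesgue I" "\<And>x. x \<in> I \<Longrightarrow> 0 < f x"
  shows "0 < avg I f"
proof -
  have nn: "0 \<le> indicator I x *\<^sub>R f x" for x
    using assms(4)[of x] by (auto simp: indicator_def)
  have "(LINT x:I|lebesgue. f x) \<noteq> 0"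
  proof
    assume "(LINT x:I|lebesgue. f x) = 0"
    then have "AE x in lebesgue. indicator I x *\<^sub>R f x = 0"
      using integral_nonneg_eq_0_iff_AE[OF assms(1)[unfolded set_integrable_def]] nn
      by (simp add: set_lebesgue_integral_def)
    then have "AE x in lebesgue. x \<notin> I"
      by eventually_elim (use assms(4) in \<open>force simp: indicator_def split: if_splits\<close>)
    then have "I \<in> null_sets lebesgue"
      using assms(2) AE_iff_null_sets by blast
    then show False using assms(3) by (simp add: measure_eq_0_null_sets)
  qed
  moreover have "0 \<le> (LINT x:I|lebesgue. f x)"
    unfolding set_lebesgue_integral_def by (intro integral_nonneg_AE AE_I2 nn)
  ultimately show ?thesis using assms(3) by (simp add: avg_def)
qed

lemma A1_cond_reverse_Hoelder:
  assumes A1: "A1_cond {a<..<b} \<phi> c" and "a < b" and "1 < c" and p: "1 \<le> p" "p < c / (c - 1)"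
  shows "set_integrable lebesgue {a<..<b} (\<lambda>x. \<phi> x powr p)"
    and "avg {a<..<b} (\<lambda>x. \<phi> x powr p)
           \<le> 1 / (c powr (p - 1) * (c + p - p * c)) * avg {a<..<b} \<phi> powr p"
proof -
  let ?J = "{a<..<b}"
  let ?M = "lebesgue_on ?J"
  let ?m = "ess_inf_on ?J \<phi>"
  let ?A = "avg ?J \<phi>"
  have pos: "\<And>x. x \<in> ?J \<Longrightarrow> 0 < \<phi> x" using A1 by (auto simp: A1_cond_def)
  have J: "subinterval ?J ?J" using subinterval_Ioo[of a a b b] \<open>a < b\<close> by simp
  have int: "set_integrable lebesgue ?J \<phi>" using A1 J by (auto simp: A1_cond_def)
  \<comment> \<open>The \<open>A1_cond\<close> inequality on the whole interval then forces the
    essential infimum to be positive.\<close>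
  have "0 < ?A" using int pos \<open>a < b\<close> by (intro avg_pos) auto
  moreover have "?A \<le> c * ?m" using A1 J by (auto simp: A1_cond_def)
  ultimately have "0 < c * ?m" by linarith
  then have "0 < ?m" using \<open>1 < c\<close> by (simp add: zero_less_mult_iff)
  have K: "0 < c + p - p * c" using \<open>1 < c\<close> p by (intro exponent_denominator_pos)
  have "set_integrable lebesgue ?J (\<lambda>x. \<phi> x powr p) \<and> avg ?J (\<lambda>x. \<phi> x powr p)
           \<le> 1 / (c powr (p - 1) * (c + p - p * c)) * ?A powr p"
  \<comment> \<open>The layer-cake argument divides by \<open>p - 1\<close>. For
    \<open>p = 1\<close> the constant is 1 and both averages agree.\<close>
  proof (cases "p = 1")
    case True
    have "\<phi> x powr p = \<phi> x" if "x \<in> ?J" for x using pos[OF that] True by simp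
    then have "set_integrable lebesgue ?J (\<lambda>x. \<phi> x powr p) \<longleftrightarrow> set_integrable lebesgue ?J \<phi>"
      "(LINT x:?J|lebesgue. \<phi> x powr p) = (LINT x:?J|lebesgue. \<phi> x)"
      using set_integrable_cong[of lebesgue lebesgue ?J ?J "\<lambda>x. \<phi> x powr p" \<phi>]
      by (auto intro!: set_lebesgue_integral_cong)
    moreover from this have "avg ?J (\<lambda>x. \<phi> x powr p) = ?A"
      by (simp only: avg_def)
    ultimately show ?thesis using int \<open>0 < ?A\<close> \<open>1 < c\<close> True by simp
  next
    case False
    then have "1 < p" using p by simp
    interpret finite_measure ?M by (rule finite_measure_lebesgue_on) simp
    have int_iff: "integrable ?M f \<longleftrightarrow> set_integrable lebesgue ?J f"
      and int_eq: "integral\<^sup>L ?M f = (LINT x:?J|lebesgue. f x)" for f :: "real \<Rightarrow> real"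
      by (simp_all add: integrable_restrict_space integral_restrict_space set_integrable_def
          set_lebesgue_integral_def)
    have ge: "AE x in ?M. ?m \<le> \<phi> x"
      using AE_ess_inf_on_le[of ?J 0 \<phi>] pos by (simp add: AE_restrict_space_iff less_imp_le)
    have weak: "(\<integral>x. indicator {t<..} (\<phi> x) * \<phi> x \<partial>?M) \<le> c * t * measure ?M {x \<in> space ?M. t < \<phi> x}"
      if "?m < t" for t
    proof -
      let ?E = "{x \<in> ?J. t < \<phi> x}"
      have "(\<integral>x. indicator {t<..} (\<phi> x) * \<phi> x \<partial>?M) = (LINT x:?E|lebesgue. \<phi> x)"
        unfolding int_eq unfolding set_lebesgue_integral_def
        by (intro Bochner_Integration.integral_cong) (auto simp: indicator_def)
      also have "\<dots> \<le> c * t * measure lebesgue ?E"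
        using A1_cond_weak_type(2)[OF A1 \<open>a < b\<close> that] by simp
      also have "measure lebesgue ?E = measure ?M {x \<in> space ?M. t < \<phi> x}"
        by (subst measure_restrict_space) (auto simp: space_restrict_space)
      finally show ?thesis .
    qed
    have bound: "integrable ?M (\<lambda>x. \<phi> x powr p)"
      "(c + p - p * c) * (\<integral>x. \<phi> x powr p \<partial>?M)
           \<le> p * ?m powr (p - 1) * (\<integral>x. \<phi> x \<partial>?M) - c * (p - 1) * ?m powr p * measure ?M (space ?M)"
      using weak_type_imp_powr_bound[OF _ \<open>0 < ?m\<close> ge \<open>1 < p\<close> _ weak K] int \<open>1 < c\<close>
      by (simp_all add: int_iff)
    have "measure ?M (space ?M) = b - a"
      using \<open>a < b\<close> by (simp add: measure_restrict_space)
    moreover have "(LINT x:?J|lebesgue. f x) = avg ?J f * (b - a)" for f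
      using \<open>a < b\<close> by (simp add: avg_def)
    ultimately have "((c + p - p * c) * avg ?J (\<lambda>x. \<phi> x powr p)) * (b - a)
        \<le> (p * ?m powr (p - 1) * ?A - c * (p - 1) * ?m powr p) * (b - a)"
      using bound(2) by (simp only: int_eq left_diff_distrib mult.assoc)
    then have "(c + p - p * c) * avg ?J (\<lambda>x. \<phi> x powr p)
        \<le> p * ?m powr (p - 1) * ?A - c * (p - 1) * ?m powr p"
      using \<open>a < b\<close> by (simp add: mult_le_cancel_right)
    also have "\<dots> \<le> ?A powr p / c powr (p - 1)"
      using \<open>1 < c\<close> \<open>0 < ?m\<close> \<open>0 < ?A\<close> p by (intro powr_bound_maximum) auto
    finally have "avg ?J (\<lambda>x. \<phi> x powr p) \<le> ?A powr p / c powr (p - 1) / (c + p - p * c)"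
      by (subst pos_le_divide_eq[OF K]) (simp only: mult.commute)
    then show ?thesis using bound(1) by (simp add: int_iff)
  qed
  then show "set_integrable lebesgue ?J (\<lambda>x. \<phi> x powr p)"
    "avg ?J (\<lambda>x. \<phi> x powr p) \<le> 1 / (c powr (p - 1) * (c + p - p * c)) * ?A powr p" by auto
qed

lemma A1_cond_subset:
  assumes "A1_cond J \<phi> c" "I \<subseteq> J"
  shows "A1_cond I \<phi> c"
  using assms unfolding A1_cond_def subinterval_def by (meson subset_iff)

text \<open>The condition restricts to the open interval between the endpoints of \<open>I\<close>,
  where the whole-interval result applies; the endpoints do not affect the averages.\<close>

lemma A1_cond_reverse_Hoelder_subinterval:
  assumes A1: "A1_cond {a<..<b} \<phi> c" and "1 < c" and p: "1 \<le> p" "p < c / (c - 1)"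
    and I: "subinterval I {a<..<b}"
  shows "avg I (\<lambda>x. \<phi> x powr p)
           \<le> 1 / (c powr (p - 1) * (c + p - p * c)) * avg I \<phi> powr p"
proof -
  obtain u v where uv: "a \<le> u" "u < v" "v \<le> b" "{u<..<v} \<subseteq> I" "I \<subseteq> {u..v}"
    using subinterval_between[OF I] .
  have I_sets: "I \<in> sets lebesgue" by (rule subinterval_sets(1)[OF I])
  have "a < b" using uv by linarith
  have avg_eq: "avg I f = avg {u<..<v} f" if "set_integrable lebesgue {a<..<b} f" for f
  proof -
    have "set_integrable lebesgue I f" "set_integrable lebesgue {u<..<v} f"
      using that I I_sets uv(4) by (auto intro: set_integrable_subset simp: subinterval_def)
    then have "(LINT x:I|lebesgue. f x) = (LINT x:{u<..<v}|lebesgue. f x)"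
      by (rule set_integral_cong_set'[OF _ _ AE_Ioo_iff_between[OF uv(4,5)]])
    then show ?thesis
      using measure_between[OF uv(4,5) I_sets] uv(2) by (simp add: avg_def)
  qed
  have "A1_cond {u<..<v} \<phi> c" using uv by (intro A1_cond_subset[OF A1]) auto
  then have "avg {u<..<v} (\<lambda>x. \<phi> x powr p)
           \<le> 1 / (c powr (p - 1) * (c + p - p * c)) * avg {u<..<v} \<phi> powr p"
    using A1_cond_reverse_Hoelder(2) uv(2) \<open>1 < c\<close> p by blast
  then show ?thesis
    using avg_eq A1_cond_reverse_Hoelder(1)[OF A1 \<open>a < b\<close> \<open>1 < c\<close> p]
      A1_cond_set_integrable_Ioo[OF A1 _ \<open>a < b\<close>] by simp
qed

subsection \<open>The extremal power functions\<close>

lemma set_integral_powr_from_0: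
  fixes r b :: real
  assumes "0 < r" "0 \<le> b"
  shows "set_integrable lebesgue {0..b} (\<lambda>x. x powr (r - 1))"
    and "(LINT x:{0..b}|lebesgue. x powr (r - 1)) = b powr r / r"
proof -
  have I: "((\<lambda>x. x powr (r - 1)) has_integral (b powr r / r)) {0..b}"
    using has_integral_powr_from_0[of "r - 1" b] assms by simp
  then show "set_integrable lebesgue {0..b} (\<lambda>x. x powr (r - 1))"
    by (intro nonnegative_absolutely_integrable_1) auto
  then show "(LINT x:{0..b}|lebesgue. x powr (r - 1)) = b powr r / r"
    using I by (simp add: set_lebesgue_integral_eq_integral(2) integral_unique)
qed

text \<open>Obtained by subtracting two integrals that start at 0, so \<open>u = 0\<close> is
  included although the integrand is singular there for \<open>r < 1\<close>.\<close>

lemma set_integral_powr_between: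
  fixes r u v :: real
  assumes "0 < r" "0 \<le> u" "u < v" and I: "{u<..<v} \<subseteq> I" "I \<subseteq> {u..v}" "I \<in> sets lebesgue"
  shows "set_integrable lebesgue I (\<lambda>x. x powr (r - 1))"
    and "(LINT x:I|lebesgue. x powr (r - 1)) = (v powr r - u powr r) / r"
proof -
  let ?f = "\<lambda>x::real. x powr (r - 1)"
  have int: "set_integrable lebesgue {0..v} ?f"
    using assms by (intro set_integral_powr_from_0) auto
  show int_I: "set_integrable lebesgue I ?f"
    using assms by (intro set_integrable_subset[OF int]) auto
  have "{0..v} = {0..u} \<union> {u<..v}" using assms by auto
  then have "(LINT x:{0..v}|lebesgue. ?f x) = (LINT x:{0..u} \<union> {u<..v}|lebesgue. ?f x)"
    by simp
  also have "\<dots> = (LINT x:{0..u}|lebesgue. ?f x) + (LINT x:{u<..v}|lebesgue. ?f x)"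
    using assms by (intro set_integral_Un set_integrable_subset[OF int]) auto
  also have "(LINT x:{u<..v}|lebesgue. ?f x) = (LINT x:I|lebesgue. ?f x)"
    using assms int_I
    by (intro set_integral_cong_set' set_integrable_subset[OF int] AE_I'[of "{u, v}"])
       (auto simp: less_le)
  finally show "(LINT x:I|lebesgue. ?f x) = (v powr r - u powr r) / r"
    using assms by (simp add: set_integral_powr_from_0 diff_divide_distrib)
qed

lemma avg_powr_unit_interval:
  fixes r :: real
  assumes "0 < r"
  shows "avg {0<..<1} (\<lambda>x. x powr (r - 1)) = 1 / r"
  using set_integral_powr_between(2)[of r 0 1 "{0<..<1}"] assms
  by (simp add: avg_def greaterThanLessThan_subseteq_atLeastAtMost_iff)

lemma ess_inf_on_powr_unit_interval_le:
  fixes s :: real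
  assumes "s < 1"
  shows "ess_inf_on {0<..<1} (\<lambda>x. x powr (s - 1)) \<le> 1" (is "?e \<le> 1")
proof (rule ccontr)
  assume "\<not> ?e \<le> 1"
  \<comment> \<open>\<open>q\<close> is the point where the decreasing power equals
    \<open>?e\<close>. Since \<open>?e > 1\<close> and the exponent is negative,
    \<open>q < 1\<close>, and the power falls below \<open>?e\<close> on all of
    \<open>{q<..<1}\<close>.\<close>
  define q where "q = ?e powr (1 / (s - 1))"
  have "0 < q" using \<open>\<not> ?e \<le> 1\<close> by (auto simp: q_def)
  have "q < 1" unfolding q_def
    using \<open>\<not> ?e \<le> 1\<close> \<open>s < 1\<close> powr_less_mono[of "1 / (s - 1)" 0 ?e] by simp
  have "AE x in lebesgue. x \<in> {0<..<1} \<longrightarrow> ?e \<le> x powr (s - 1)"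
    by (intro AE_ess_inf_on_le[of _ 0] AE_I2) auto
  then have "AE x in lebesgue. x \<notin> {q<..<1}"
  proof eventually_elim
    case (elim x)
    have "x powr (s - 1) < ?e" if "q < x"
    proof -
      have "x powr (s - 1) < q powr (s - 1)"
        using that \<open>0 < q\<close> \<open>s < 1\<close> by (intro powr_less_mono2_neg) auto
      also have "q powr (s - 1) = ?e"
        using \<open>\<not> ?e \<le> 1\<close> \<open>s < 1\<close> by (simp add: q_def powr_powr)
      finally show ?thesis .
    qed
    then show ?case using elim \<open>0 < q\<close> by force
  qed
  then have "{q<..<1} \<in> null_sets lebesgue"
    using AE_iff_null_sets[of "{q<..<1}" lebesgue] by simp
  then have "measure lebesgue {q<..<1} = 0"
    by (simp add: measure_eq_0_null_sets)
  then show False using \<open>q < 1\<close> by simp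
qed

text \<open>The power is decreasing, so its essential infimum between \<open>u\<close> and
  \<open>v\<close> is at least its value at \<open>v\<close>; the average is at most
  \<open>c\<close> times that value. On the whole unit interval the average is \<open>c\<close> and
  the essential infimum at most 1, so no smaller constant is admissible.\<close>

lemma A1_class_powr:
  fixes c :: real
  assumes "1 < c"
  shows "A1_class {0<..<1} c (\<lambda>x. x powr (1 / c - 1))"
proof -
  let ?s = "1 / c"
  let ?\<phi> = "\<lambda>x::real. x powr (?s - 1)"
  have s: "0 < ?s" "?s < 1" using assms by auto
  have int: "set_integrable lebesgue I ?\<phi>" and le: "avg I ?\<phi> \<le> c * ess_inf_on I ?\<phi>"
    if I: "subinterval I {0<..<1}" for I
  proof -
    obtain u v where uv: "0 \<le> u" "u < v" "v \<le> 1" "{u<..<v} \<subseteq> I" "I \<subseteq> {u..v}"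
      using subinterval_between[OF I] .
    have sets: "I \<in> sets lebesgue" by (rule subinterval_sets(1)[OF I])
    show "set_integrable lebesgue I ?\<phi>"
      using set_integral_powr_between(1)[OF s(1) uv(1,2,4,5) sets] .
    \<comment> \<open>This is \<open>u\<close> times the monotonicity of the power, and it is
      exactly what the bound on the average needs.\<close>
    have "u * v powr (?s - 1) \<le> u powr ?s"
    proof (cases "u = 0")
      case False
      then have "v powr (?s - 1) \<le> u powr (?s - 1)"
        using uv s by (intro powr_mono2') auto
      then show ?thesis
        using False uv(1) powr_mult_base[of u "?s - 1"] by (auto dest: mult_left_mono[of _ _ u])
    qed simp
    moreover have "v powr ?s = v * v powr (?s - 1)"
      using uv by (simp add: powr_mult_base)
    ultimately have "(v powr ?s - u powr ?s) \<le> v powr (?s - 1) * (v - u)"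
      by (simp add: algebra_simps)
    then have "avg I ?\<phi> \<le> c * v powr (?s - 1)"
      using uv assms
      by (simp add: avg_def measure_between[OF uv(4,5) sets] pos_divide_le_eq mult.assoc
          set_integral_powr_between(2)[OF s(1) uv(1,2,4,5) sets])
    also have "\<dots> \<le> c * ess_inf_on I ?\<phi>"
    proof (intro mult_left_mono ess_inf_on_greatest subinterval_sets[OF I] AE_I2 impI)
      fix x assume "x \<in> I"
      then have "0 < x" "x \<le> v" using uv(5) I by (auto simp: subinterval_def)
      then show "v powr (?s - 1) \<le> x powr (?s - 1)" using s by (intro powr_mono2') auto
    qed (use assms in auto)
    finally show "avg I ?\<phi> \<le> c * ess_inf_on I ?\<phi>" .
  qed
  have A1: "A1_cond {0<..<1} ?\<phi> c"
    using assms int le by (auto simp: A1_cond_def)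
  have "c \<le> c'" if c': "A1_cond {0<..<1} ?\<phi> c'" for c'
  proof -
    have "c = avg {0<..<1} ?\<phi>"
      using avg_powr_unit_interval[OF s(1)] by simp
    also have "\<dots> \<le> c' * ess_inf_on {0<..<1} ?\<phi>"
      using c' subinterval_Ioo[of 0 0 1 1] by (auto simp: A1_cond_def)
    also have "\<dots> \<le> c' * 1"
      using c' ess_inf_on_powr_unit_interval_le[OF s(2)]
      by (intro mult_left_mono) (auto simp: A1_cond_def)
    finally show ?thesis by simp
  qed
  then have "A1_const {0<..<1} ?\<phi> = c"
    unfolding A1_const_def using A1 by (intro cInf_eq_minimum) auto
  then show ?thesis using A1 by (auto simp: A1_class_def)
qed

lemma avg_powr_extremal:
  fixes c p :: real
  assumes "1 < c" "1 \<le> p" "p < c / (c - 1)"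
  shows "avg {0<..<1} (\<lambda>x. x powr (1 / c - 1)) = c"
    and "avg {0<..<1} (\<lambda>x. (x powr (1 / c - 1)) powr p) = c / (c + p - p * c)"
proof -
  \<comment> \<open>\<open>r\<close> is one more than the exponent \<open>(1 / c - 1) * p\<close> of
    the composed power.\<close>
  define r where "r = (c + p - p * c) / c"
  have "0 < r" using exponent_denominator_pos[of c p] assms by (simp add: r_def)
  have "(1 / c - 1) * p = r - 1" using assms by (simp add: r_def field_simps)
  then have "avg {0<..<1} (\<lambda>x. (x powr (1 / c - 1)) powr p) = 1 / r"
    using avg_powr_unit_interval[OF \<open>0 < r\<close>] by (simp add: powr_powr)
  then show "avg {0<..<1} (\<lambda>x. (x powr (1 / c - 1)) powr p) = c / (c + p - p * c)"
    by (simp add: r_def)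
  show "avg {0<..<1} (\<lambda>x. x powr (1 / c - 1)) = c"
    using assms avg_powr_unit_interval[of "1 / c"] by simp
qed

theorem theorem2:
  shows "(\<forall>c::real. \<forall>\<phi>. c > 1 \<longrightarrow> A1_class {0<..<1} c \<phi> \<longrightarrow>
            (\<forall>p::real. 1 \<le> p \<and> p < c / (c - 1) \<longrightarrow>
               set_integrable lebesgue {0<..<1} (\<lambda>x. \<phi> x powr p) \<and>
               (\<forall>I. subinterval I {0<..<1} \<longrightarrow>
                  avg I (\<lambda>x. \<phi> x powr p)
                    \<le> 1 / (c powr (p - 1) * (c + p - p * c)) * (avg I \<phi>) powr p)))
       \<and> (\<forall>c::real. \<forall>p::real. c > 1 \<longrightarrow> 1 \<le> p \<longrightarrow> p < c / (c - 1) \<longrightarrow>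
            (\<forall>K. K < 1 / (c powr (p - 1) * (c + p - p * c)) \<longrightarrow>
               (\<exists>\<phi> I. A1_class {0<..<1} c \<phi> \<and> subinterval I {0<..<1} \<and>
                  avg I (\<lambda>x. \<phi> x powr p) > K * (avg I \<phi>) powr p)))"
proof (intro conjI allI impI)
  fix c p :: real and \<phi> :: "real \<Rightarrow> real"
  assume "1 < c" "A1_class {0<..<1} c \<phi>" "1 \<le> p \<and> p < c / (c - 1)"
  \<comment> \<open>\<open>A1_class\<close> only says that \<open>c\<close> is an infimum; its being
    attained makes \<open>c\<close> itself admissible.\<close>
  then have A1: "A1_cond {0<..<1} \<phi> c" and p: "1 \<le> p" "p < c / (c - 1)"
    using A1_cond_A1_const by (auto simp: A1_class_def)
  show "set_integrable lebesgue {0<..<1} (\<lambda>x. \<phi> x powr p)"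
    using A1_cond_reverse_Hoelder(1)[OF A1 _ \<open>1 < c\<close> p] by simp
  show "avg I (\<lambda>x. \<phi> x powr p) \<le> 1 / (c powr (p - 1) * (c + p - p * c)) * (avg I \<phi>) powr p"
    if "subinterval I {0<..<1}" for I
    using A1_cond_reverse_Hoelder_subinterval[OF A1 \<open>1 < c\<close> p that] .
next
  fix c p K :: real
  assume c: "1 < c" and p: "1 \<le> p" "p < c / (c - 1)"
    and K: "K < 1 / (c powr (p - 1) * (c + p - p * c))"
  let ?\<phi> = "\<lambda>x::real. x powr (1 / c - 1)"
  \<comment> \<open>The extremal power has average \<open>c\<close>, so the claimed bound for it is
    \<open>c powr p / (c powr (p - 1) * (c + p - p * c))\<close>. This equals
    \<open>c / (c + p - p * c)\<close>, the average of its \<open>p\<close>-th power, and any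
    smaller constant fails.\<close>
  have "c powr p = c * c powr (p - 1)" using c by (simp add: powr_mult_base)
  then have "K * c powr p < c / (c + p - p * c)"
    using mult_strict_right_mono[OF K, of "c powr p"] c by simp
  then have "K * avg {0<..<1} ?\<phi> powr p < avg {0<..<1} (\<lambda>x. ?\<phi> x powr p)"
    by (simp only: avg_powr_extremal[OF c p])
  then show "\<exists>\<phi> I. A1_class {0<..<1} c \<phi> \<and> subinterval I {0<..<1} \<and>
      avg I (\<lambda>x. \<phi> x powr p) > K * (avg I \<phi>) powr p"
    using A1_class_powr[OF c] subinterval_Ioo[of 0 0 1 1]
    by (intro exI[of _ ?\<phi>] exI[of _ "{0<..<1}"]) simp
qed

end
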